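(* Let $\pi_A:A\to\mathbb A$ be a vector bundle with typical fibre $F_A$ and let $\mathfrak g$ be a pseudo-metric on $A$ compatible with a metric $\mathbf g$ on $\mathbb A$, a connection $\gamma$ on $A$ and a solder form $\vartheta$ on $A$. Then for all $a\in A$, $$H_a^{\gamma-\vartheta}A\subset\ker_a\mathfrak g,\qquad \dim\mathbb A\le\dim(\ker_a\mathfrak g)\le\dim F_A .$$ In particular, when $\dim\mathbb A=\dim F_A$, one has $\ker\mathfrak g=H^{\gamma-\vartheta}A$, i.e. $\ker_a\mathfrak g=H_a^{\gamma-\vartheta}A$ for all $a\in A$.
   Context: A vector bundle here is a smooth (at least $C^1$) surjection $\pi_A:A\to\mathbb A$ between smooth connected orientable manifolds, locally trivial with typical fibre a finite-dimensional real vector space $F_A$ and transition maps linear on fibres; $\bar a=\pi_A(a)$. Trivialising coordinates $(\bar x,y)$ on $A$ ($\bar x$ on $\mathbb A$, $y$ affine on the fibres) induce coordinates $(\bar x,y,\delta\bar x,\delta y)$ on $TA$. $VA=\ker T\pi_A$. A connection on $A$ is a smooth map $\gamma:A\times_{\mathbb A}T\mathbb A\to TA$ such that each $\gamma_a=\gamma(a,\cdot):T_{\bar a}\mathbb A\to T_aA$ is linear with $T\pi_A\circ\gamma_a=\mathrm{Id}$, and such that the coordinates $(\delta\bar x,\delta y)$ of $\gamma(a,\bar u)$ are affine in the fibre coordinate $y$ of $a$. A solder form on $A$ is a smooth injective map $\vartheta:A\times_{\mathbb A}T\mathbb A\to TA$ such that each $\vartheta_a:T_{\bar a}\mathbb A\to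 V_aA$ is linear with values in $V_aA$, and the coordinates $(\delta\bar x,\delta y)$ of $\vartheta(a,\bar u)$ are affine in $y$. $\gamma-\vartheta$ denotes $(\gamma-\vartheta)_a=\gamma_a-\vartheta_a$, and $H_a^{\gamma-\vartheta}A=(\gamma_a-\vartheta_a)(T_{\bar a}\mathbb A)\subset T_aA$. A pseudo-metric $\mathfrak g$ on $A$ is a smooth field of symmetric positive semi-definite bilinear forms $\langle\cdot,\cdot\rangle_{\mathfrak g}$ on the tangent spaces $T_aA$; its kernel at $a$ is $\ker_a\mathfrak g=\{u\in T_aA:\langle u,w\rangle_{\mathfrak g}=0\ \forall w\in T_aA\}$. It is compatible with $\mathbf g,\gamma,\vartheta$ if for all $a\in A$ and $\bar u,\bar w,\bar u',\bar w'\in T_{\bar a}\mathbb A$, $$\langle\vartheta_a\bar u+\gamma_a\bar w,\ \vartheta_a\bar u'+\gamma_a\bar w'\rangle_{\mathfrak g}=\langle\bar u+\bar w,\ \bar u'+\bar w'\rangle_{\mathbf g}.$$ *)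

theory Defs
  imports "HOL-Analysis.Analysis" "HOL-Library.Function_Algebras" "HOL-Library.Extended_Nat"
begin

section \<open>Pointwise real vector space structure on functions\<close>

instantiation "fun" :: (type, scaleR) scaleR
begin
definition scaleR_fun :: "real \<Rightarrow> ('a \<Rightarrow> 'b) \<Rightarrow> 'a \<Rightarrow> 'b" where
  "scaleR_fun r f = (\<lambda>x. r *\<^sub>R f x)"
instance ..
end

instance "fun" :: (type, real_vector) real_vector
  by standard (simp_all add: scaleR_fun_def fun_eq_iff scaleR_right_distrib scaleR_left_distrib)

lemma scaleR_fun_apply [simp]: "(r *\<^sub>R f) x = r *\<^sub>R f x"
  by (simp add: scaleR_fun_def)


section \<open>Calculus on linear subspaces\<close>

text \<open>Throughout, model spaces and fibres are linear subspaces of a Euclidean type rather than the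
  whole type. Euclidean types have positive dimension, so this is what admits dimension \<open>0\<close>.\<close>

definition linear_betw :: "'v::real_vector set \<Rightarrow> 'w::real_vector set \<Rightarrow> ('v \<Rightarrow> 'w) \<Rightarrow> bool" where
  "linear_betw V W f \<longleftrightarrow>
     f ` V \<subseteq> W \<and>
     (\<forall>u\<in>V. \<forall>v\<in>V. f (u + v) = f u + f v) \<and>
     (\<forall>r. \<forall>u\<in>V. f (r *\<^sub>R u) = r *\<^sub>R f u)"

definition affine_on :: "'v::real_vector set \<Rightarrow> ('v \<Rightarrow> 'w::real_vector) \<Rightarrow> bool" where
  "affine_on V f \<longleftrightarrow> (\<exists>L b. linear L \<and> (\<forall>y\<in>V. f y = L y + b))"

text \<open>\<open>Cn_on n E U f\<close>: \<open>f\<close> is of class \<open>C\<^sup>n\<close> on \<open>U\<close>, a relatively open subset of the subspace \<open>E\<close>.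
  The derivative within \<open>E\<close> is determined on the directions \<open>v \<in> E\<close>, which are the only ones used.\<close>

primrec Cn_on :: "nat \<Rightarrow> 'e::euclidean_space set \<Rightarrow> 'e set \<Rightarrow> ('e \<Rightarrow> 'x::real_normed_vector) \<Rightarrow> bool" where
  "Cn_on 0 E U f \<longleftrightarrow> continuous_on U f"
| "Cn_on (Suc n) E U f \<longleftrightarrow>
     (\<forall>x\<in>U. f differentiable (at x within E)) \<and>
     (\<forall>v\<in>E. Cn_on n E U (\<lambda>x. frechet_derivative f (at x within E) v))"

definition smooth_on :: "enat \<Rightarrow> 'e::euclidean_space set \<Rightarrow> 'e set \<Rightarrow> ('e \<Rightarrow> 'x::real_normed_vector) \<Rightarrow> bool" where
  "smooth_on k E U f \<longleftrightarrow> (\<forall>n. enat n \<le> k \<longrightarrow> Cn_on n E U f)"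

definition orthonormal_basis :: "'e::euclidean_space set \<Rightarrow> 'e set \<Rightarrow> bool" where
  "orthonormal_basis E B \<longleftrightarrow> pairwise orthogonal B \<and> (\<forall>b\<in>B. norm b = 1) \<and> span B = E"

text \<open>Determinant of the endomorphism \<open>L\<close> of \<open>span B\<close>, for an orthonormal family \<open>B\<close>.\<close>

definition det_wrt :: "'e::euclidean_space set \<Rightarrow> ('e \<Rightarrow> 'e) \<Rightarrow> real" where
  "det_wrt B L = (\<Sum>p | p permutes B. of_int (sign p) * (\<Prod>b\<in>B. L b \<bullet> p b))"


section \<open>Manifolds\<close>

type_synonym ('a, 'e) chart = "'a set \<times> ('a \<Rightarrow> 'e)"

text \<open>The topology of a manifold is the one induced by its atlas.\<close>

record ('a, 'e) mfd =
  model :: "'e set"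
  charts :: "('a, 'e) chart set"

definition points :: "('a, 'e) mfd \<Rightarrow> 'a set" where
  "points M = (\<Union>(U, \<phi>)\<in>charts M. U)"

definition mtop :: "('a, 'e::topological_space) mfd \<Rightarrow> 'a topology" where
  "mtop M = topology_generated_by {{p\<in>U. \<phi> p \<in> S} | U \<phi> S. (U, \<phi>) \<in> charts M \<and> open S}"

definition local_rep :: "('a, 'e) chart \<Rightarrow> ('b, 'd) chart \<Rightarrow> ('a \<Rightarrow> 'b) \<Rightarrow> 'e \<Rightarrow> 'd" where
  "local_rep c d f = snd d \<circ> f \<circ> inv_into (fst c) (snd c)"

definition mdim :: "('a, 'e::euclidean_space) mfd \<Rightarrow> nat" where
  "mdim M = dim (model M)"

definition manifold :: "enat \<Rightarrow> ('a, 'e::euclidean_space) mfd \<Rightarrow> bool" where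
  "manifold r M \<longleftrightarrow>
     subspace (model M) \<and>
     (\<forall>(U, \<phi>)\<in>charts M. inj_on \<phi> U \<and> openin (top_of_set (model M)) (\<phi> ` U)) \<and>
     (\<forall>c\<in>charts M. \<forall>d\<in>charts M.
        openin (top_of_set (model M)) (snd c ` (fst c \<inter> fst d)) \<and>
        smooth_on r (model M) (snd c ` (fst c \<inter> fst d)) (local_rep c d id)) \<and>
     Hausdorff_space (mtop M) \<and> second_countable (mtop M)"

definition orientable :: "enat \<Rightarrow> ('a, 'e::euclidean_space) mfd \<Rightarrow> bool" where
  "orientable r M \<longleftrightarrow> (\<exists>C B.
     (\<Union>(U, \<phi>)\<in>C. U) = points M \<and>
     manifold r (M\<lparr>charts := charts M \<union> C\<rparr>) \<and>
     orthonormal_basis (model M) B \<and>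
     (\<forall>c\<in>C. \<forall>d\<in>C. \<forall>p\<in>fst c \<inter> fst d.
        det_wrt B (frechet_derivative (local_rep c d id) (at (snd c p) within model M)) > 0))"

definition smooth_map :: "enat \<Rightarrow> ('a, 'e::euclidean_space) mfd \<Rightarrow> ('b, 'd::euclidean_space) mfd \<Rightarrow> ('a \<Rightarrow> 'b) \<Rightarrow> bool" where
  "smooth_map k M N f \<longleftrightarrow>
     continuous_map (mtop M) (mtop N) f \<and>
     (\<forall>c\<in>charts M. \<forall>d\<in>charts N.
        smooth_on k (model M) (snd c ` {p\<in>fst c. f p \<in> fst d}) (local_rep c d f))"

definition diffeo :: "enat \<Rightarrow> ('a, 'e::euclidean_space) mfd \<Rightarrow> ('b, 'd::euclidean_space) mfd \<Rightarrow> ('a \<Rightarrow> 'b) \<Rightarrow> bool" where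
  "diffeo k M N f \<longleftrightarrow>
     bij_betw f (points M) (points N) \<and>
     smooth_map k M N f \<and> smooth_map k N M (inv_into (points M) f)"

definition open_sub :: "('a, 'e) mfd \<Rightarrow> 'a set \<Rightarrow> ('a, 'e) mfd" where
  "open_sub M W = \<lparr>model = model M, charts = {(U \<inter> W, \<phi>) | U \<phi>. (U, \<phi>) \<in> charts M}\<rparr>"

definition vs_mfd :: "'f set \<Rightarrow> ('f, 'f) mfd" where
  "vs_mfd F = \<lparr>model = F, charts = {(F, id)}\<rparr>"

definition prod_mfd :: "('a, 'e) mfd \<Rightarrow> ('b, 'd) mfd \<Rightarrow> ('a \<times> 'b, 'e \<times> 'd) mfd" where
  "prod_mfd M N = \<lparr>model = model M \<times> model N,
     charts = {(U \<times> V, map_prod \<phi> \<psi>) | U \<phi> V \<psi>. (U, \<phi>) \<in> charts M \<and> (V, \<psi>) \<in> charts N}\<rparr>"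


section \<open>Tangent spaces and tangent bundle\<close>

text \<open>A tangent vector at \<open>p\<close> is the family of its components in all charts around \<open>p\<close>, related by the
  derivatives of the transition maps; components in the other charts are set to \<open>0\<close>. The vector
  space operations are the pointwise ones.\<close>

type_synonym ('a, 'e) tvec = "('a, 'e) chart \<Rightarrow> 'e"

definition charts_at :: "('a, 'e) mfd \<Rightarrow> 'a \<Rightarrow> ('a, 'e) chart set" where
  "charts_at M p = {c\<in>charts M. p \<in> fst c}"

definition tangent_space :: "('a, 'e::euclidean_space) mfd \<Rightarrow> 'a \<Rightarrow> ('a, 'e) tvec set" where
  "tangent_space M p = {v.
     (\<forall>c\<in>charts_at M p. v c \<in> model M) \<and>
     (\<forall>c\<in>charts_at M p. \<forall>d\<in>charts_at M p.
        v d = frechet_derivative (local_rep c d id) (at (snd c p) within model M) (v c)) \<and>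
     (\<forall>c. c \<notin> charts_at M p \<longrightarrow> v c = 0)}"

text \<open>The tangent vector at \<open>p\<close> whose component in the chart \<open>c\<close> is \<open>w\<close>.\<close>

definition tvec_of :: "('a, 'e::euclidean_space) mfd \<Rightarrow> ('a, 'e) chart \<Rightarrow> 'a \<Rightarrow> 'e \<Rightarrow> ('a, 'e) tvec" where
  "tvec_of M c p w = (\<lambda>d. if d \<in> charts_at M p
     then frechet_derivative (local_rep c d id) (at (snd c p) within model M) w else 0)"

text \<open>The tangent map \<open>T\<^sub>p f\<close>, computed in an arbitrary chart around \<open>p\<close>.\<close>

definition tangent_map :: "('a, 'e::euclidean_space) mfd \<Rightarrow> ('b, 'd::euclidean_space) mfd \<Rightarrow> ('a \<Rightarrow> 'b)
    \<Rightarrow> 'a \<Rightarrow> ('a, 'e) tvec \<Rightarrow> ('b, 'd) tvec" where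
  "tangent_map M N f p v = (let c = (SOME c. c \<in> charts_at M p) in
     (\<lambda>d. if d \<in> charts_at N (f p)
        then frechet_derivative (local_rep c d f) (at (snd c p) within model M) (v c) else 0))"

definition tangent_bundle :: "('a, 'e::euclidean_space) mfd \<Rightarrow> ('a \<times> ('a, 'e) tvec, 'e \<times> 'e) mfd" where
  "tangent_bundle M = \<lparr>model = model M \<times> model M,
     charts = {({(p, v). p \<in> fst c \<and> v \<in> tangent_space M p}, \<lambda>(p, v). (snd c p, v c)) | c. c \<in> charts M}\<rparr>"

definition bilinear_form_on :: "'v::real_vector set \<Rightarrow> ('v \<Rightarrow> 'v \<Rightarrow> real) \<Rightarrow> bool" where
  "bilinear_form_on V h \<longleftrightarrow>
     (\<forall>u\<in>V. linear_betw V UNIV (h u)) \<and> (\<forall>u\<in>V. linear_betw V UNIV (\<lambda>v. h v u))"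

type_synonym ('a, 'e) form_field = "'a \<Rightarrow> ('a, 'e) tvec \<Rightarrow> ('a, 'e) tvec \<Rightarrow> real"

definition smooth_form_field :: "enat \<Rightarrow> ('a, 'e::euclidean_space) mfd \<Rightarrow> ('a, 'e) form_field \<Rightarrow> bool" where
  "smooth_form_field k M h \<longleftrightarrow>
     (\<forall>p\<in>points M. bilinear_form_on (tangent_space M p) (h p)) \<and>
     (\<forall>c\<in>charts M. \<forall>v\<in>model M. \<forall>w\<in>model M.
        smooth_on k (model M) (snd c ` fst c)
          (\<lambda>x. let p = inv_into (fst c) (snd c) x in h p (tvec_of M c p v) (tvec_of M c p w)))"

definition pseudo_metric :: "enat \<Rightarrow> ('a, 'e::euclidean_space) mfd \<Rightarrow> ('a, 'e) form_field \<Rightarrow> bool" where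
  "pseudo_metric k M h \<longleftrightarrow> smooth_form_field k M h \<and>
     (\<forall>p\<in>points M. \<forall>u\<in>tangent_space M p. \<forall>v\<in>tangent_space M p. h p u v = h p v u) \<and>
     (\<forall>p\<in>points M. \<forall>u\<in>tangent_space M p. h p u u \<ge> 0)"

definition riemannian_metric :: "enat \<Rightarrow> ('a, 'e::euclidean_space) mfd \<Rightarrow> ('a, 'e) form_field \<Rightarrow> bool" where
  "riemannian_metric k M h \<longleftrightarrow> pseudo_metric k M h \<and>
     (\<forall>p\<in>points M. \<forall>u\<in>tangent_space M p. u \<noteq> 0 \<longrightarrow> h p u u > 0)"

definition metric_kernel :: "('a, 'e::euclidean_space) mfd \<Rightarrow> ('a, 'e) form_field \<Rightarrow> 'a \<Rightarrow> ('a, 'e) tvec set" where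
  "metric_kernel M h p = {u\<in>tangent_space M p. \<forall>w\<in>tangent_space M p. h p u w = 0}"


section \<open>Vector bundles\<close>

text \<open>A local trivialisation \<open>(W, \<Phi>)\<close> consists of an open set \<open>W\<close> of the base and the fibre component
  \<open>\<Phi>\<close> of the trivialising map \<open>a \<mapsto> (\<pi> a, \<Phi> a)\<close> over \<open>W\<close>.\<close>

type_synonym ('a, 'b, 'f) triv = "'b set \<times> ('a \<Rightarrow> 'f)"

record ('a, 'e, 'b, 'd, 'f) vbundle =
  total_space :: "('a, 'e) mfd"
  base_space :: "('b, 'd) mfd"
  proj :: "'a \<Rightarrow> 'b"
  fibre :: "'f set"
  trivs :: "('a, 'b, 'f) triv set"

definition over :: "('a, 'e, 'b, 'd, 'f) vbundle \<Rightarrow> 'b set \<Rightarrow> 'a set" where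
  "over A W = {a\<in>points (total_space A). proj A a \<in> W}"

definition triv_map :: "('a, 'e, 'b, 'd, 'f) vbundle \<Rightarrow> ('a, 'b, 'f) triv \<Rightarrow> 'a \<Rightarrow> 'b \<times> 'f" where
  "triv_map A t a = (proj A a, snd t a)"

definition triv_inv :: "('a, 'e, 'b, 'd, 'f) vbundle \<Rightarrow> ('a, 'b, 'f) triv \<Rightarrow> 'b \<times> 'f \<Rightarrow> 'a" where
  "triv_inv A t = inv_into (over A (fst t)) (triv_map A t)"

text \<open>The manifolds are of class \<open>C\<close>\<open>\<^sup>k\<^sup>+\<^sup>1\<close>, so that the tangent bundles are of class \<open>C\<^sup>k\<close> and
  maps of class \<open>C\<^sup>k\<close> into them make sense. For \<open>k = \<infinity>\<close> everything is \<open>C\<^sup>\<infinity>\<close>.\<close>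

definition vector_bundle ::
  "enat \<Rightarrow> ('a, 'e::euclidean_space, 'b, 'd::euclidean_space, 'f::euclidean_space) vbundle \<Rightarrow> bool" where
  "vector_bundle k A \<longleftrightarrow>
     manifold (k + 1) (total_space A) \<and> connected_space (mtop (total_space A)) \<and> orientable (k + 1) (total_space A) \<and>
     manifold (k + 1) (base_space A) \<and> connected_space (mtop (base_space A)) \<and> orientable (k + 1) (base_space A) \<and>
     smooth_map k (total_space A) (base_space A) (proj A) \<and>
     proj A ` points (total_space A) = points (base_space A) \<and>
     subspace (fibre A) \<and>
     (\<Union>t\<in>trivs A. fst t) = points (base_space A) \<and>
     (\<forall>t\<in>trivs A. openin (mtop (base_space A)) (fst t) \<and>
        diffeo k (open_sub (total_space A) (over A (fst t)))
          (prod_mfd (open_sub (base_space A) (fst t)) (vs_mfd (fibre A))) (triv_map A t)) \<and>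
     (\<forall>t\<in>trivs A. \<forall>t'\<in>trivs A. \<forall>p\<in>fst t \<inter> fst t'.
        linear_betw (fibre A) (fibre A) (\<lambda>y. snd t' (triv_inv A t (p, y))))"

text \<open>The fibre product of the total space and the tangent bundle of the base, over the base, as a
  manifold: \<open>(a, u)\<close> has the coordinates of \<open>a\<close> in a chart \<open>c\<close> of the total space, and the components
  of \<open>u\<close> in a chart \<open>d\<close> of the base.\<close>

definition pullback_tangent :: "('a, 'e::euclidean_space, 'b, 'd::euclidean_space, 'f) vbundle
    \<Rightarrow> ('a \<times> ('b, 'd) tvec, 'e \<times> 'd) mfd" where
  "pullback_tangent A = \<lparr>model = model (total_space A) \<times> model (base_space A),
     charts = {({(a, u). a \<in> fst c \<and> proj A a \<in> fst d \<and> u \<in> tangent_space (base_space A) (proj A a)},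
                \<lambda>(a, u). (snd c a, u d)) | c d. c \<in> charts (total_space A) \<and> d \<in> charts (base_space A)}\<rparr>"

abbreviation base_tangent :: "('a, 'e, 'b, 'd::euclidean_space, 'f) vbundle \<Rightarrow> 'a \<Rightarrow> ('b, 'd) tvec set" where
  "base_tangent A a \<equiv> tangent_space (base_space A) (proj A a)"

abbreviation total_tangent :: "('a, 'e::euclidean_space, 'b, 'd, 'f) vbundle \<Rightarrow> 'a \<Rightarrow> ('a, 'e) tvec set" where
  "total_tangent A a \<equiv> tangent_space (total_space A) a"

abbreviation tproj :: "('a, 'e::euclidean_space, 'b, 'd::euclidean_space, 'f) vbundle
    \<Rightarrow> 'a \<Rightarrow> ('a, 'e) tvec \<Rightarrow> ('b, 'd) tvec" where
  "tproj A \<equiv> tangent_map (total_space A) (base_space A) (proj A)"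

definition vertical :: "('a, 'e::euclidean_space, 'b, 'd::euclidean_space, 'f) vbundle \<Rightarrow> 'a \<Rightarrow> ('a, 'e) tvec set" where
  "vertical A a = {v\<in>total_tangent A a. tproj A a v = 0}"

text \<open>The coordinates \<open>(\<delta>x, \<delta>y)\<close> of \<open>v \<in> T\<^sub>a A\<close> induced by a chart \<open>d\<close> of the base and a local
  trivialisation \<open>t\<close>.\<close>

definition triv_coords :: "('a, 'e::euclidean_space, 'b, 'd::euclidean_space, 'f::euclidean_space) vbundle
    \<Rightarrow> ('a, 'b, 'f) triv \<Rightarrow> ('b, 'd) chart \<Rightarrow> 'a \<Rightarrow> ('a, 'e) tvec \<Rightarrow> 'd \<times> 'f" where
  "triv_coords A t d a v =
     (tproj A a v d, tangent_map (total_space A) (vs_mfd (fibre A)) (snd t) a v (fibre A, id))"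

type_synonym ('a, 'e, 'b, 'd) lift = "'a \<Rightarrow> ('b, 'd) tvec \<Rightarrow> ('a, 'e) tvec"

text \<open>In trivialising coordinates, \<open>\<eta>(a, u)\<close> depends affinely on the fibre coordinate \<open>y\<close> of \<open>a\<close>,
  the base point \<open>p\<close> of \<open>a\<close> and \<open>u\<close> being fixed.\<close>

definition affine_in_fibre :: "('a, 'e::euclidean_space, 'b, 'd::euclidean_space, 'f::euclidean_space) vbundle
    \<Rightarrow> ('a, 'e, 'b, 'd) lift \<Rightarrow> bool" where
  "affine_in_fibre A \<eta> \<longleftrightarrow>
     (\<forall>t\<in>trivs A. \<forall>d\<in>charts (base_space A). \<forall>p\<in>fst t \<inter> fst d. \<forall>u\<in>tangent_space (base_space A) p.
        affine_on (fibre A) (\<lambda>y. let a = triv_inv A t (p, y) in triv_coords A t d a (\<eta> a u)))"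

definition smooth_lift :: "enat \<Rightarrow> ('a, 'e::euclidean_space, 'b, 'd::euclidean_space, 'f) vbundle
    \<Rightarrow> ('a, 'e, 'b, 'd) lift \<Rightarrow> bool" where
  "smooth_lift k A \<eta> \<longleftrightarrow>
     smooth_map k (pullback_tangent A) (tangent_bundle (total_space A)) (\<lambda>(a, u). (a, \<eta> a u))"

definition connection :: "enat \<Rightarrow> ('a, 'e::euclidean_space, 'b, 'd::euclidean_space, 'f::euclidean_space) vbundle
    \<Rightarrow> ('a, 'e, 'b, 'd) lift \<Rightarrow> bool" where
  "connection k A \<gamma> \<longleftrightarrow>
     smooth_lift k A \<gamma> \<and>
     (\<forall>a\<in>points (total_space A). linear_betw (base_tangent A a) (total_tangent A a) (\<gamma> a) \<and>
        (\<forall>u\<in>base_tangent A a. tproj A a (\<gamma> a u) = u)) \<and>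
     affine_in_fibre A \<gamma>"

definition solder_form :: "enat \<Rightarrow> ('a, 'e::euclidean_space, 'b, 'd::euclidean_space, 'f::euclidean_space) vbundle
    \<Rightarrow> ('a, 'e, 'b, 'd) lift \<Rightarrow> bool" where
  "solder_form k A \<theta> \<longleftrightarrow>
     smooth_lift k A \<theta> \<and>
     inj_on (\<lambda>(a, u). (a, \<theta> a u)) (points (pullback_tangent A)) \<and>
     (\<forall>a\<in>points (total_space A). linear_betw (base_tangent A a) (vertical A a) (\<theta> a)) \<and>
     affine_in_fibre A \<theta>"

definition horizontal :: "('a, 'e::euclidean_space, 'b, 'd::euclidean_space, 'f) vbundle
    \<Rightarrow> ('a, 'e, 'b, 'd) lift \<Rightarrow> 'a \<Rightarrow> ('a, 'e) tvec set" where
  "horizontal A \<eta> a = \<eta> a ` base_tangent A a"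

definition compatible :: "('a, 'e::euclidean_space, 'b, 'd::euclidean_space, 'f) vbundle
    \<Rightarrow> ('b, 'd) form_field \<Rightarrow> ('a, 'e, 'b, 'd) lift \<Rightarrow> ('a, 'e, 'b, 'd) lift
    \<Rightarrow> ('a, 'e) form_field \<Rightarrow> bool" where
  "compatible A g \<gamma> \<theta> h \<longleftrightarrow>
     (\<forall>a\<in>points (total_space A). \<forall>u\<in>base_tangent A a. \<forall>w\<in>base_tangent A a.
      \<forall>u'\<in>base_tangent A a. \<forall>w'\<in>base_tangent A a.
        h a (\<theta> a u + \<gamma> a w) (\<theta> a u' + \<gamma> a w') = g (proj A a) (u + w) (u' + w'))"

end

theory Submission
  imports Defs
begin

text \<open>For \<open>x = \<gamma> u - \<theta> u\<close>, compatibility gives \<open>\<langle>x, x\<rangle> = \<langle>u - u, u - u\<rangle> = 0\<close>, and a null vector of a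
  semi-definite form lies in its kernel. Applying \<open>T\<pi>\<close> shows that \<open>\<gamma> - \<theta>\<close> is injective, so the kernel
  has dimension at least that of the base. It meets the image of \<open>\<gamma>\<close> only in \<open>0\<close>, since
  \<open>\<langle>\<gamma> u, \<gamma> u\<rangle> = \<langle>u, u\<rangle>\<close>. Hence its dimension is at most the codimension of that image, which is the
  dimension of the fibre.\<close>

section \<open>Linear maps on subspaces\<close>

text \<open>Bridges \<open>linear_betw\<close>, which says nothing off \<open>V\<close>, and
  \<open>linear\<close>. The extension is prescribed on a basis of \<open>V\<close>; the points of
  \<open>V\<close> where the two maps agree form a subspace containing that basis, hence all of
  \<open>V\<close>.\<close>

lemma linear_betw_extend:
  fixes f :: "'v::real_vector \<Rightarrow> 'w::real_vector"
  assumes "subspace V" "linear_betw V W f"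
  obtains g where "linear g" "\<And>v. v \<in> V \<Longrightarrow> g v = f v"
proof -
  obtain B where B: "B \<subseteq> V" "independent B" "V \<subseteq> span B" "card B = dim V"
    using basis_exists by blast
  obtain g where g: "linear g" "\<forall>b\<in>B. g b = f b"
    using linear_independent_extend[OF B(2)] by blast
  have "subspace {v\<in>V. g v = f v}"
  proof -
    have "f (0 *\<^sub>R 0) = 0 *\<^sub>R f 0"
      using assms subspace_0 unfolding linear_betw_def by blast
    then show ?thesis
      using assms g(1) unfolding subspace_def linear_betw_def
      by (auto simp: linear_add linear_scale linear_0)
  qed
  moreover have "B \<subseteq> {v\<in>V. g v = f v}"
    using B(1) g(2) by auto
  ultimately have "V \<subseteq> {v\<in>V. g v = f v}"
    using B(3) span_minimal by blast
  with g(1) show thesis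
    using that by auto
qed

text \<open>Stated for arbitrary real vector spaces because tangent vectors are functions on charts.
  A basis of \<open>V\<close> is carried to an independent family with the same cardinality that
  spans the image.\<close>

lemma dim_linear_image_inj_on:
  fixes f :: "'v::real_vector \<Rightarrow> 'w::real_vector"
  assumes f: "linear f" and V: "subspace V" and inj: "inj_on f V"
  shows "dim (f ` V) = dim V"
proof -
  obtain B where B: "B \<subseteq> V" "independent B" "V \<subseteq> span B" "card B = dim V"
    using basis_exists by blast
  have sp: "span B = V"
    using B V by (simp add: span_minimal subset_antisym)
  have "independent (f ` B)"
    using linear_independent_injective_image linear_inj_on_span_independent_image f B(2) inj sp by metis
  moreover have "span (f ` B) = span (f ` V)"
    using linear_span_image[OF f] sp V by (metis span_eq_iff span_span)
  ultimately have "dim (f ` V) = card (f ` B)"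
    by (intro dim_eq_card)
  also have "\<dots> = card B"
    using B(1) inj by (meson card_image inj_on_subset)
  finally show ?thesis
    using B(4) by simp
qed

lemma linear_betw_image:
  fixes f :: "'v::real_vector \<Rightarrow> 'w::real_vector"
  assumes "subspace V" "linear_betw V W f" "inj_on f V"
  shows "subspace (f ` V)" "dim (f ` V) = dim V"
proof -
  obtain g where g: "linear g" "\<And>v. v \<in> V \<Longrightarrow> g v = f v"
    using linear_betw_extend assms by blast
  then have *: "f ` V = g ` V" "inj_on g V"
    using assms(3) by (auto simp: inj_on_def)
  show "subspace (f ` V)"
    unfolding * by (intro linear_subspace_image g(1) assms(1))
  show "dim (f ` V) = dim V"
    unfolding *(1) by (intro dim_linear_image_inj_on g(1) assms(1) *(2))
qed

lemma bilinear_form_onD: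
  assumes "bilinear_form_on V h" "u \<in> V" "v \<in> V" "w \<in> V"
  shows "h (u + v) w = h u w + h v w" "h w (u + v) = h w u + h w v"
    "h (r *\<^sub>R u) w = r * h u w" "h w (r *\<^sub>R u) = r * h w u"
  using assms unfolding bilinear_form_on_def linear_betw_def by auto

text \<open>As \<open>h u u = 0\<close>, the quadratic term along the line
  \<open>w + t *\<^sub>R u\<close> vanishes. What remains is affine in \<open>t\<close>, and it is
  bounded below only if its slope \<open>2 * h u w\<close> is zero.\<close>

lemma semidefinite_null_vector:
  assumes V: "subspace V" and h: "bilinear_form_on V h"
    and sym: "\<And>u v. u \<in> V \<Longrightarrow> v \<in> V \<Longrightarrow> h u v = h v u"
    and pos: "\<And>u. u \<in> V \<Longrightarrow> h u u \<ge> 0"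
    and u: "u \<in> V" "h u u = 0" and w: "w \<in> V"
  shows "h u w = 0"
proof (rule ccontr)
  assume nz: "h u w \<noteq> 0"
  \<comment> \<open>The solution of \<open>h w w + 2 * t * h u w = -1\<close>.\<close>
  define t where "t = - (h w w + 1) / (2 * h u w)"
  have tu: "t *\<^sub>R u \<in> V"
    using V u by (simp add: subspace_scale)
  have "0 \<le> h (w + t *\<^sub>R u) (w + t *\<^sub>R u)"
    using pos V tu w by (simp add: subspace_add)
  also have "\<dots> = h w w + 2 * t * h u w"
    using tu w u V sym by (simp add: bilinear_form_onD[OF h] subspace_add algebra_simps)
  also have "\<dots> = -1"
    using nz by (simp add: t_def field_simps)
  finally show False by simp
qed


section \<open>Derivatives within a subspace\<close>

lemma at_within_openin:
  assumes "openin (top_of_set E) S" "x \<in> S"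
  shows "at x within S = at x within E"
proof -
  obtain T where "open T" "S = E \<inter> T"
    using assms(1) by (auto simp: openin_open)
  then show ?thesis
    using assms(2) by (intro at_within_nhd[of x T]) auto
qed

text \<open>A derivative within a proper subspace is undetermined in directions leaving it. For
  \<open>v\<close> in \<open>E\<close> the line through \<open>x\<close> in direction
  \<open>v\<close> stays in \<open>E\<close>, and uniqueness reduces to derivatives in one real
  variable.\<close>

lemma has_derivative_within_subspace_unique:
  fixes f :: "'e::real_normed_vector \<Rightarrow> 'x::real_normed_vector"
  assumes E: "subspace E" and x: "x \<in> E" and v: "v \<in> E"
    and A: "(f has_derivative A) (at x within E)" and B: "(f has_derivative B) (at x within E)"
  shows "A v = B v"
proof -
  define l where "l = (\<lambda>t::real. x + t *\<^sub>R v)"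
  have l: "(l has_derivative (\<lambda>t. t *\<^sub>R v)) (at 0)"
    unfolding l_def by (auto intro!: derivative_eq_intros)
  have sub: "range l \<subseteq> E"
    using E x v by (auto simp: l_def subspace_add subspace_scale)
  have l0: "l 0 = x"
    by (simp add: l_def)
  have "((f \<circ> l) has_derivative (A \<circ> (\<lambda>t. t *\<^sub>R v))) (at 0)"
    using diff_chain_within[OF l] has_derivative_subset[OF A sub] l0 by simp
  moreover have "((f \<circ> l) has_derivative (B \<circ> (\<lambda>t. t *\<^sub>R v))) (at 0)"
    using diff_chain_within[OF l] has_derivative_subset[OF B sub] l0 by simp
  ultimately have "A \<circ> (\<lambda>t. t *\<^sub>R v) = B \<circ> (\<lambda>t. t *\<^sub>R v)"
    by (rule has_derivative_unique)
  from fun_cong[OF this, of 1] show ?thesis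
    by simp
qed

text \<open>Local representatives are meaningful only on chart images, so \<open>F\<close> is
  required to land in \<open>E'\<close> on \<open>S\<close> alone. Since \<open>S\<close> is open in
  \<open>E\<close>, the derivative at \<open>x\<close> may be taken within \<open>S\<close>
  instead.\<close>

lemma has_derivative_within_chain:
  assumes S: "openin (top_of_set E) S" "x \<in> S" and FS: "F ` S \<subseteq> E'"
    and F: "(F has_derivative F') (at x within E)"
    and G: "(G has_derivative G') (at (F x) within E')"
  shows "((G \<circ> F) has_derivative (G' \<circ> F')) (at x within E)"
proof -
  have "(F has_derivative F') (at x within S)"
    using F S by (simp add: at_within_openin)
  then have "((G \<circ> F) has_derivative (G' \<circ> F')) (at x within S)"
    by (rule diff_chain_within) (rule has_derivative_subset[OF G FS])
  then show ?thesis
    using S by (simp add: at_within_openin)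
qed

lemma has_derivative_within_cong:
  assumes S: "openin (top_of_set E) S" "x \<in> S" and eq: "\<And>z. z \<in> S \<Longrightarrow> F z = G z"
    and F: "(F has_derivative F') (at x within E)"
  shows "(G has_derivative F') (at x within E)"
proof -
  have "(F has_derivative F') (at x within S)"
    using F S by (simp add: at_within_openin)
  then have "(G has_derivative F') (at x within S)"
    using S(2) eq by (metis has_derivative_transform)
  then show ?thesis
    using S by (simp add: at_within_openin)
qed

text \<open>A linear projection onto \<open>E'\<close> leaves \<open>F\<close> unchanged on
  \<open>S\<close>, so composing \<open>F'\<close> with it gives another derivative of
  \<open>F\<close>. By uniqueness it agrees with \<open>F'\<close> on \<open>E\<close>.\<close>

lemma has_derivative_within_range:
  fixes F :: "'e::real_normed_vector \<Rightarrow> 'x::euclidean_space"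
  assumes E: "subspace E" "subspace E'" and S: "openin (top_of_set E) S" "x \<in> S" and FS: "F ` S \<subseteq> E'"
    and F: "(F has_derivative F') (at x within E)" and v: "v \<in> E"
  shows "F' v \<in> E'"
proof -
  \<comment> \<open>A left inverse of the identity on \<open>E'\<close> is a linear projection onto
    \<open>E'\<close>.\<close>
  obtain P :: "'x \<Rightarrow> 'x" where P: "range P \<subseteq> E'" "linear P" "\<forall>v\<in>E'. P v = v"
    using linear_exists_left_inverse_on[OF linear_ident E(2)] by auto
  have "((P \<circ> F) has_derivative (P \<circ> F')) (at x within E)"
    using S FS F P(2)
    by (intro has_derivative_within_chain) (auto intro: linear_imp_has_derivative)
  then have "(F has_derivative (P \<circ> F')) (at x within E)"
    by (rule has_derivative_within_cong[OF S, rotated]) (use P(3) FS in auto)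
  moreover have "x \<in> E"
    using S openin_imp_subset by blast
  ultimately have "F' v = (P \<circ> F') v"
    using has_derivative_within_subspace_unique[OF E(1) _ v F] by blast
  then show ?thesis
    using P(1) by (metis comp_apply rangeI subsetD)
qed

text \<open>Differentiating \<open>G (F z) = z\<close> at \<open>x\<close> shows that
  \<open>G'\<close> inverts \<open>F'\<close> on \<open>E\<close>. Thus \<open>F'\<close> embeds
  \<open>E\<close> linearly into \<open>E'\<close>.\<close>

lemma dim_le_of_local_left_inverse:
  fixes F :: "'e::euclidean_space \<Rightarrow> 'x::euclidean_space"
  assumes E: "subspace E" "subspace E'" and S: "openin (top_of_set E) S" "x \<in> S" and FS: "F ` S \<subseteq> E'"
    and F: "F differentiable (at x within E)" and G: "G differentiable (at (F x) within E')"
    and GF: "\<And>z. z \<in> S \<Longrightarrow> G (F z) = z"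
  shows "dim E \<le> dim E'"
proof -
  obtain F' G' where F': "(F has_derivative F') (at x within E)"
    and G': "(G has_derivative G') (at (F x) within E')"
    using F G unfolding differentiable_def by blast
  have xE: "x \<in> E"
    using S openin_imp_subset by blast
  have "((\<lambda>z. z) has_derivative (G' \<circ> F')) (at x within E)"
    using GF by (intro has_derivative_within_cong[OF S _ has_derivative_within_chain[OF S FS F' G']]) auto
  then have inv: "G' (F' v) = v" if "v \<in> E" for v
    using has_derivative_within_subspace_unique[OF E(1) xE that _ has_derivative_ident[of "at x within E"]]
    by fastforce
  have "dim E = dim (F' ` E)"
    using E(1) F' inv by (metis dim_linear_image_inj_on has_derivative_linear inj_on_inverseI)
  also have "\<dots> \<le> dim E'"
    using has_derivative_within_range[OF E S FS F'] by (intro dim_subset) auto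
  finally show ?thesis .
qed


section \<open>Topology of atlases\<close>

text \<open>Weaker than \<open>manifold\<close>, and easily inherited by the open submanifolds and products in which
  local trivialisations live.\<close>

definition continuous_atlas :: "('a, 'e::euclidean_space) mfd \<Rightarrow> bool" where
  "continuous_atlas M \<longleftrightarrow>
     subspace (model M) \<and> (\<forall>c\<in>charts M. inj_on (snd c) (fst c)) \<and>
     (\<forall>c\<in>charts M. \<forall>d\<in>charts M.
        openin (top_of_set (model M)) (snd c ` (fst c \<inter> fst d)) \<and>
        continuous_on (snd c ` (fst c \<inter> fst d)) (local_rep c d id))"

lemma continuous_atlasD:
  assumes "continuous_atlas M" "c \<in> charts M"
  shows "subspace (model M)" "inj_on (snd c) (fst c)"
    and "d \<in> charts M \<Longrightarrow> openin (top_of_set (model M)) (snd c ` (fst c \<inter> fst d))"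
    and "d \<in> charts M \<Longrightarrow> continuous_on (snd c ` (fst c \<inter> fst d)) (local_rep c d id)"
  using assms unfolding continuous_atlas_def by blast+

lemma continuous_atlasI:
  assumes "subspace (model M)" "\<And>U \<phi>. (U, \<phi>) \<in> charts M \<Longrightarrow> inj_on \<phi> U"
    and "\<And>U \<phi> V \<psi>. (U, \<phi>) \<in> charts M \<Longrightarrow> (V, \<psi>) \<in> charts M \<Longrightarrow>
      openin (top_of_set (model M)) (\<phi> ` (U \<inter> V)) \<and> continuous_on (\<phi> ` (U \<inter> V)) (local_rep (U, \<phi>) (V, \<psi>) id)"
  shows "continuous_atlas M"
  unfolding continuous_atlas_def
proof (intro conjI ballI)
  show "inj_on (snd c) (fst c)" if "c \<in> charts M" for c
    using assms(2)[of "fst c" "snd c"] that by simp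
  show "openin (top_of_set (model M)) (snd c ` (fst c \<inter> fst d))"
    and "continuous_on (snd c ` (fst c \<inter> fst d)) (local_rep c d id)"
    if "c \<in> charts M" "d \<in> charts M" for c d
    using assms(3)[of "fst c" "snd c" "fst d" "snd d"] that by simp_all
qed (rule assms(1))

lemma local_rep_apply: "inj_on (snd c) (fst c) \<Longrightarrow> p \<in> fst c \<Longrightarrow> local_rep c d f (snd c p) = snd d (f p)"
  by (simp add: local_rep_def)

lemma manifold_chartsD:
  assumes "manifold r M" "c \<in> charts M"
  shows "inj_on (snd c) (fst c)"
proof -
  have "\<forall>(U, \<phi>)\<in>charts M. inj_on \<phi> U"
    using assms(1) unfolding manifold_def by blast
  then show ?thesis
    using assms(2) by (simp add: case_prod_unfold)
qed

lemma smooth_on_continuous: "smooth_on k E U f \<Longrightarrow> continuous_on U f"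
  unfolding smooth_on_def by (drule spec[of _ 0]) (simp add: zero_enat_def[symmetric])

lemma smooth_on_differentiable:
  assumes "smooth_on k E U f" "1 \<le> k" "x \<in> U"
  shows "f differentiable (at x within E)"
proof -
  have "Cn_on (Suc 0) E U f"
    using assms(1,2) unfolding smooth_on_def by (metis One_nat_def one_enat_def)
  then show ?thesis
    using assms(3) by simp
qed

lemma manifold_transition:
  assumes "manifold r M" "c \<in> charts M" "d \<in> charts M"
  shows "openin (top_of_set (model M)) (snd c ` (fst c \<inter> fst d))"
    and "smooth_on r (model M) (snd c ` (fst c \<inter> fst d)) (local_rep c d id)"
  using assms unfolding manifold_def by blast+

lemma manifold_continuous_atlas:
  assumes "manifold r M"
  shows "continuous_atlas M"
proof -
  have "subspace (model M)"
    using assms by (simp add: manifold_def)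
  then show ?thesis
    unfolding continuous_atlas_def
    using manifold_chartsD[OF assms] manifold_transition[OF assms] smooth_on_continuous by blast
qed

lemma openin_chart_domain:
  assumes "c \<in> charts M"
  shows "openin (mtop M) (fst c)"
proof -
  have "fst c = {p\<in>fst c. snd c p \<in> UNIV}"
    by simp
  then show ?thesis
    unfolding mtop_def using assms
    by (intro topology_generated_by_Basis CollectI) (metis open_UNIV prod.collapse)
qed

lemma points_eq: "points M = (\<Union>c\<in>charts M. fst c)"
  by (auto simp: points_def)

lemma topspace_mtop: "topspace (mtop M) = points M"
proof
  show "topspace (mtop M) \<subseteq> points M"
    unfolding mtop_def topology_generated_by_topspace by (auto simp: points_eq)
  show "points M \<subseteq> topspace (mtop M)"
    unfolding points_eq using openin_chart_domain openin_subset by (intro UN_least) blast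
qed

text \<open>Induction on the generation of the topology from chart preimages. A generator coming
  from another chart becomes the preimage of an open set under a continuous transition map;
  injectivity of the chart handles intersections.\<close>

lemma openin_chart_image:
  assumes M: "continuous_atlas M" and c: "c \<in> charts M" and S: "openin (mtop M) S"
  shows "openin (top_of_set (model M)) (snd c ` (fst c \<inter> S))"
proof -
  have inj: "inj_on (snd c) (fst c)"
    using M c by (simp add: continuous_atlas_def)
  from S have "generate_topology_on {{p\<in>U. \<phi> p \<in> S} | U \<phi> S. (U, \<phi>) \<in> charts M \<and> open S} S"
    unfolding mtop_def by (rule openin_topology_generated_by)
  then show ?thesis
  proof induct
    case Empty
    then show ?case by simp
  next
    case (Int a b)
    have "snd c ` (fst c \<inter> (a \<inter> b)) = snd c ` (fst c \<inter> a) \<inter> snd c ` (fst c \<inter> b)"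
      using inj by (auto simp: inj_on_def)
    then show ?case
      using Int by (simp add: openin_Int)
  next
    case (UN K)
    have "snd c ` (fst c \<inter> \<Union>K) = (\<Union>k\<in>K. snd c ` (fst c \<inter> k))"
      by auto
    then show ?case
      using UN by auto
  next
    case (Basis s)
    then obtain d T where d: "d \<in> charts M" "open T" "s = {p\<in>fst d. snd d p \<in> T}"
      by fastforce
    let ?D = "snd c ` (fst c \<inter> fst d)"
    have "openin (top_of_set ?D) (?D \<inter> local_rep c d id -` T)"
      using M c d by (intro continuous_openin_preimage_gen) (auto simp: continuous_atlas_def)
    moreover have "?D \<inter> local_rep c d id -` T = snd c ` (fst c \<inter> s)"
      using inj by (auto simp: d(3) local_rep_apply)
    ultimately show ?case
      using continuous_atlasD(3)[OF M c d(1)] openin_trans by metis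
  qed
qed

section \<open>Atlases of open submanifolds, products and vector spaces\<close>

lemma continuous_atlas_open_sub:
  assumes M: "continuous_atlas M" and W: "openin (mtop M) W"
  shows "continuous_atlas (open_sub M W)"
proof -
  have "openin (top_of_set (model M)) (\<phi> ` (U \<inter> W \<inter> (V \<inter> W))) \<and>
        continuous_on (\<phi> ` (U \<inter> W \<inter> (V \<inter> W))) (local_rep (U \<inter> W, \<phi>) (V \<inter> W, \<psi>) id)"
    if c: "(U, \<phi>) \<in> charts M" "(V, \<psi>) \<in> charts M" for U \<phi> V \<psi>
  proof
    have eq: "U \<inter> W \<inter> (V \<inter> W) = U \<inter> (V \<inter> W)"
      by auto
    show "openin (top_of_set (model M)) (\<phi> ` (U \<inter> W \<inter> (V \<inter> W)))"
      unfolding eq using openin_chart_image[OF M c(1), of "V \<inter> W"] openin_chart_domain[OF c(2)] W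
      by (simp add: openin_Int)
    have inj: "inj_on \<phi> U"
      using continuous_atlasD(2)[OF M c(1)] by simp
    then have injW: "inj_on \<phi> (U \<inter> W)"
      by (rule inj_on_subset) auto
    have "continuous_on (\<phi> ` (U \<inter> V)) (local_rep (U, \<phi>) (V, \<psi>) id)"
      using continuous_atlasD(4)[OF M c] by simp
    then have "continuous_on (\<phi> ` (U \<inter> W \<inter> (V \<inter> W))) (local_rep (U, \<phi>) (V, \<psi>) id)"
      by (rule continuous_on_subset) auto
    \<comment> \<open>Shrinking a chart domain changes \<open>inv_into\<close>, so the two local
      representatives are compared only on the image of the smaller overlap.\<close>
    then show "continuous_on (\<phi> ` (U \<inter> W \<inter> (V \<inter> W))) (local_rep (U \<inter> W, \<phi>) (V \<inter> W, \<psi>) id)"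
    proof (rule continuous_on_eq)
      fix z assume "z \<in> \<phi> ` (U \<inter> W \<inter> (V \<inter> W))"
      then obtain p where p: "p \<in> U" "p \<in> W" "z = \<phi> p"
        by blast
      then show "local_rep (U, \<phi>) (V, \<psi>) id z = local_rep (U \<inter> W, \<phi>) (V \<inter> W, \<psi>) id z"
        unfolding local_rep_def using inv_into_f_f[OF inj] inv_into_f_f[OF injW] by simp
    qed
  qed
  moreover have "inj_on \<phi> (U \<inter> W)" if "(U, \<phi>) \<in> charts M" for U \<phi>
    using continuous_atlasD(2)[OF M that] by (simp add: inj_on_Int)
  moreover have "subspace (model M)"
    using M by (simp add: continuous_atlas_def)
  ultimately show ?thesis
    by (intro continuous_atlasI) (auto simp: open_sub_def simp del: Int_iff)
qed

lemma continuous_atlas_prod: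
  assumes M: "continuous_atlas M" and N: "continuous_atlas N"
  shows "continuous_atlas (prod_mfd M N)"
proof -
  have "openin (top_of_set (model M \<times> model N)) (map_prod \<phi> \<psi> ` (U \<times> V \<inter> U' \<times> V')) \<and>
        continuous_on (map_prod \<phi> \<psi> ` (U \<times> V \<inter> U' \<times> V'))
          (local_rep (U \<times> V, map_prod \<phi> \<psi>) (U' \<times> V', map_prod \<phi>' \<psi>') id)"
    if c: "(U, \<phi>) \<in> charts M" "(U', \<phi>') \<in> charts M" "(V, \<psi>) \<in> charts N" "(V', \<psi>') \<in> charts N"
    for U \<phi> V \<psi> U' \<phi>' V' \<psi>'
  proof
    have eq: "map_prod \<phi> \<psi> ` (U \<times> V \<inter> U' \<times> V') = \<phi> ` (U \<inter> U') \<times> \<psi> ` (V \<inter> V')"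
      unfolding Times_Int_Times by (rule map_prod_surj_on) auto
    have o: "openin (top_of_set (model M)) (\<phi> ` (U \<inter> U'))"
         "openin (top_of_set (model N)) (\<psi> ` (V \<inter> V'))"
      and k: "continuous_on (\<phi> ` (U \<inter> U')) (local_rep (U, \<phi>) (U', \<phi>') id)"
         "continuous_on (\<psi> ` (V \<inter> V')) (local_rep (V, \<psi>) (V', \<psi>') id)"
      and inj: "inj_on \<phi> U" "inj_on \<psi> V"
      using continuous_atlasD[OF M c(1)] continuous_atlasD[OF N c(3)] c(2,4)
      by (metis fst_conv snd_conv)+
    show "openin (top_of_set (model M \<times> model N)) (map_prod \<phi> \<psi> ` (U \<times> V \<inter> U' \<times> V'))"
      unfolding eq using o by (rule openin_Times)
    have injp: "inj_on (map_prod \<phi> \<psi>) (U \<times> V)"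
      using inj by (rule map_prod_inj_on)
    have "continuous_on (\<phi> ` (U \<inter> U') \<times> \<psi> ` (V \<inter> V'))
        (\<lambda>z. (local_rep (U, \<phi>) (U', \<phi>') id (fst z), local_rep (V, \<psi>) (V', \<psi>') id (snd z)))"
      by (intro continuous_on_Pair continuous_on_compose2[OF k(1)] continuous_on_compose2[OF k(2)]
          continuous_on_fst continuous_on_snd continuous_on_id) auto
    then show "continuous_on (map_prod \<phi> \<psi> ` (U \<times> V \<inter> U' \<times> V'))
          (local_rep (U \<times> V, map_prod \<phi> \<psi>) (U' \<times> V', map_prod \<phi>' \<psi>') id)"
      unfolding eq
    proof (rule continuous_on_eq)
      fix z assume "z \<in> \<phi> ` (U \<inter> U') \<times> \<psi> ` (V \<inter> V')"
      then obtain p q where pq: "p \<in> U" "q \<in> V" "z = map_prod \<phi> \<psi> (p, q)"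
        by auto
      then show "(local_rep (U, \<phi>) (U', \<phi>') id (fst z), local_rep (V, \<psi>) (V', \<psi>') id (snd z)) =
          local_rep (U \<times> V, map_prod \<phi> \<psi>) (U' \<times> V', map_prod \<phi>' \<psi>') id z"
        using inv_into_f_f[OF injp, of "(p, q)"] inv_into_f_f[OF inj(1)] inv_into_f_f[OF inj(2)]
        by (simp add: local_rep_def)
    qed
  qed
  moreover have "inj_on (map_prod \<phi> \<psi>) (U \<times> V)" if "(U, \<phi>) \<in> charts M" "(V, \<psi>) \<in> charts N" for U \<phi> V \<psi>
    using continuous_atlasD(2)[OF M that(1)] continuous_atlasD(2)[OF N that(2)] by (simp add: map_prod_inj_on)
  moreover have "subspace (model M \<times> model N)"
    using M N by (simp add: continuous_atlas_def subspace_Times)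
  moreover have "\<exists>U \<phi> V \<psi>. c = (U \<times> V, map_prod \<phi> \<psi>) \<and> (U, \<phi>) \<in> charts M \<and> (V, \<psi>) \<in> charts N"
    if "c \<in> charts (prod_mfd M N)" for c
    using that by (simp add: prod_mfd_def)
  moreover have "model (prod_mfd M N) = model M \<times> model N"
    by (simp add: prod_mfd_def)
  ultimately show ?thesis
    unfolding continuous_atlas_def by (metis fst_conv snd_conv)
qed

lemma continuous_atlas_vs_mfd:
  assumes "subspace F"
  shows "continuous_atlas (vs_mfd F)"
proof -
  have "continuous_on F (local_rep (F, id) (F, id) id)"
    by (rule continuous_on_eq[OF continuous_on_id]) (simp add: local_rep_def)
  then show ?thesis
    using assms by (simp add: continuous_atlas_def vs_mfd_def)
qed

text \<open>In charts around \<open>p\<close> and \<open>f p\<close>, the local representatives of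
  \<open>f\<close> and \<open>g\<close> form a differentiable map with a differentiable left
  inverse. This one-sided form serves both inequalities for a diffeomorphism.\<close>

lemma smooth_left_inverse_dim_le:
  assumes M: "continuous_atlas M" and N: "continuous_atlas N" and k: "1 \<le> k"
    and f: "smooth_map k M N f" and g: "smooth_map k N M g"
    and fg: "\<And>p. p \<in> points M \<Longrightarrow> f p \<in> points N" "\<And>p. p \<in> points M \<Longrightarrow> g (f p) = p"
    and p: "p \<in> points M"
  shows "mdim M \<le> mdim N"
proof -
  obtain c where c: "c \<in> charts M" "p \<in> fst c"
    using p by (auto simp: points_eq)
  obtain d where d: "d \<in> charts N" "f p \<in> fst d"
    using fg(1)[OF p] by (auto simp: points_eq)
  have cM: "fst c \<subseteq> points M"
    using c by (auto simp: points_eq)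
  have inj: "inj_on (snd c) (fst c)" "inj_on (snd d) (fst d)"
    using M N c d by (auto simp: continuous_atlas_def)
  define S where "S = snd c ` {q\<in>fst c. f q \<in> fst d}"
  \<comment> \<open>Exhibits the domain of the local representative as a chart domain cut by the
    preimage of an open set, so that continuity of \<open>f\<close> makes its image open.\<close>
  have eq: "{q\<in>fst c. f q \<in> fst d} = fst c \<inter> {q\<in>topspace (mtop M). f q \<in> fst d}"
    using cM by (auto simp: topspace_mtop)
  have S: "openin (top_of_set (model M)) S"
    unfolding S_def eq using f openin_chart_domain[OF d(1)]
    by (intro openin_chart_image[OF M c(1)] openin_continuous_map_preimage) (auto simp: smooth_map_def)
  have "snd d ` (fst d \<inter> fst d) \<subseteq> model N"
    using continuous_atlasD(3)[OF N d(1) d(1)] by (rule openin_imp_subset)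
  then have FS: "local_rep c d f ` S \<subseteq> model N"
    using inj by (auto simp: S_def local_rep_apply)
  have F: "local_rep c d f differentiable (at (snd c p) within model M)"
    using f c d k unfolding smooth_map_def by (blast intro: smooth_on_differentiable)
  have "g (f p) = p"
    using fg p by blast
  then have G: "local_rep d c g differentiable (at (local_rep c d f (snd c p)) within model N)"
    using g c d k unfolding smooth_map_def local_rep_apply[OF inj(1) c(2)]
    by (intro smooth_on_differentiable) auto
  show ?thesis
    unfolding mdim_def
  proof (rule dim_le_of_local_left_inverse[OF _ _ S _ FS F G])
    show "snd c p \<in> S"
      using c d by (auto simp: S_def)
    show "local_rep d c g (local_rep c d f z) = z" if "z \<in> S" for z
      using that inj fg cM by (auto simp: S_def local_rep_apply)
  qed (use M N in \<open>auto simp: continuous_atlas_def\<close>)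
qed

text \<open>A point is needed to have charts in which to differentiate: the dimension is read off
  \<open>model\<close>, which an empty atlas does not tie to the points.\<close>

lemma diffeo_mdim_eq:
  assumes "continuous_atlas M" "continuous_atlas N" "1 \<le> k" "diffeo k M N f" "p \<in> points M"
  shows "mdim M = mdim N"
proof (rule antisym)
  have bij: "bij_betw f (points M) (points N)"
    using assms(4) by (simp add: diffeo_def)
  show "mdim M \<le> mdim N"
    using assms bij unfolding diffeo_def
    by (intro smooth_left_inverse_dim_le[of M N k f "inv_into (points M) f" p])
      (auto simp: bij_betw_apply bij_betw_inv_into_left)
  have "f p \<in> points N"
    using bij assms(5) by (simp add: bij_betw_apply)
  then show "mdim N \<le> mdim M"
    using assms bij bij_betw_apply[OF bij_betw_inv_into[OF bij]] unfolding diffeo_def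
    by (intro smooth_left_inverse_dim_le[of N M k "inv_into (points M) f" f "f p"])
      (auto simp: bij_betw_inv_into_right)
qed


section \<open>Tangent spaces\<close>

lemma tangent_spaceD:
  assumes "v \<in> tangent_space M p"
  shows "c \<in> charts_at M p \<Longrightarrow> v c \<in> model M"
    and "c \<in> charts_at M p \<Longrightarrow> d \<in> charts_at M p \<Longrightarrow>
      v d = frechet_derivative (local_rep c d id) (at (snd c p) within model M) (v c)"
    and "c \<notin> charts_at M p \<Longrightarrow> v c = 0"
  using assms unfolding tangent_space_def by blast+

lemma tangent_spaceI:
  assumes "\<And>c. c \<in> charts_at M p \<Longrightarrow> v c \<in> model M"
    and "\<And>c d. c \<in> charts_at M p \<Longrightarrow> d \<in> charts_at M p \<Longrightarrow>
      v d = frechet_derivative (local_rep c d id) (at (snd c p) within model M) (v c)"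
    and "\<And>c. c \<notin> charts_at M p \<Longrightarrow> v c = 0"
  shows "v \<in> tangent_space M p"
  using assms unfolding tangent_space_def by blast

lemma transition_has_derivative:
  assumes "manifold r M" "1 \<le> r" "c \<in> charts_at M p" "d \<in> charts_at M p"
  shows "(local_rep c d id has_derivative frechet_derivative (local_rep c d id) (at (snd c p) within model M))
    (at (snd c p) within model M)"
proof -
  have "smooth_on r (model M) (snd c ` (fst c \<inter> fst d)) (local_rep c d id)"
    using manifold_transition(2)[OF assms(1)] assms(3,4) by (simp add: charts_at_def)
  then show ?thesis
    unfolding frechet_derivative_works[symmetric]
    using assms by (intro smooth_on_differentiable) (auto simp: charts_at_def)
qed

text \<open>With \<open>1 \<le> r\<close> the transition maps are differentiable, so the map chosen
  by \<open>frechet_derivative\<close> is a genuine derivative and hence linear; the defining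
  relations are then linear in \<open>v\<close>.\<close>

lemma subspace_tangent_space:
  assumes M: "manifold r M" and r: "1 \<le> r"
  shows "subspace (tangent_space M p)"
proof -
  have E: "subspace (model M)"
    using M by (simp add: manifold_def)
  have L: "linear (frechet_derivative (local_rep c d id) (at (snd c p) within model M))"
    if "c \<in> charts_at M p" "d \<in> charts_at M p" for c d
    using transition_has_derivative[OF M r that] has_derivative_linear by blast
  show ?thesis
    unfolding subspace_def
  proof (intro conjI ballI allI)
    show "0 \<in> tangent_space M p"
      by (rule tangent_spaceI) (simp_all add: subspace_0[OF E] linear_0[OF L])
    show "x + y \<in> tangent_space M p" if "x \<in> tangent_space M p" "y \<in> tangent_space M p" for x y
    proof (rule tangent_spaceI)
      show "(x + y) d = frechet_derivative (local_rep c d id) (at (snd c p) within model M) ((x + y) c)"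
        if cd: "c \<in> charts_at M p" "d \<in> charts_at M p" for c d
        using \<open>x \<in> _\<close>[THEN tangent_spaceD(2), OF cd] \<open>y \<in> _\<close>[THEN tangent_spaceD(2), OF cd]
        by (simp add: linear_add[OF L[OF cd]])
    qed (use that E in \<open>simp_all add: subspace_add tangent_spaceD(1,3)\<close>)
    show "a *\<^sub>R x \<in> tangent_space M p" if "x \<in> tangent_space M p" for a x
    proof (rule tangent_spaceI)
      show "(a *\<^sub>R x) d = frechet_derivative (local_rep c d id) (at (snd c p) within model M) ((a *\<^sub>R x) c)"
        if cd: "c \<in> charts_at M p" "d \<in> charts_at M p" for c d
        using \<open>x \<in> _\<close>[THEN tangent_spaceD(2), OF cd] by (simp add: linear_scale[OF L[OF cd]])
    qed (use that E in \<open>simp_all add: subspace_scale tangent_spaceD(1,3)\<close>)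
  qed
qed

text \<open>One component determines all others at \<open>p\<close> through the transition
  derivatives, and the components in charts not containing \<open>p\<close> are zero.\<close>

lemma inj_on_chart_component:
  assumes "c \<in> charts_at M p"
  shows "inj_on (\<lambda>v. v c) (tangent_space M p)"
proof (rule inj_onI, rule ext)
  fix u v d assume uv: "u \<in> tangent_space M p" "v \<in> tangent_space M p" "u c = v c"
  then show "u d = v d"
    using tangent_spaceD(2)[OF uv(1) assms, of d] tangent_spaceD(2)[OF uv(2) assms, of d]
      tangent_spaceD(3)[OF uv(1), of d] tangent_spaceD(3)[OF uv(2), of d]
    by (cases "d \<in> charts_at M p") simp_all
qed

text \<open>Compatibility of the components is the chain rule for transition maps, and the component
  in \<open>c\<close> itself comes from the transition of \<open>c\<close> to itself, which is the
  identity on the chart image. Together these make evaluation in a chart surjective onto the model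
  space.\<close>

lemma
  assumes M: "manifold r M" and r: "1 \<le> r" and c: "c \<in> charts_at M p" and w: "w \<in> model M"
  shows tvec_of_in_tangent_space: "tvec_of M c p w \<in> tangent_space M p"
    and tvec_of_component: "tvec_of M c p w c = w"
proof -
  let ?E = "model M"
  let ?D = "\<lambda>c d. frechet_derivative (local_rep c d id) (at (snd c p) within model M)"
  have E: "subspace ?E"
    using M by (simp add: manifold_def)
  have inj: "inj_on (snd d) (fst d)" if "d \<in> charts_at M p" for d
    using manifold_chartsD[OF M] that by (simp add: charts_at_def)
  have op: "openin (top_of_set ?E) (snd d ` (fst d \<inter> fst e))" "snd d p \<in> snd d ` (fst d \<inter> fst e)"
    if "d \<in> charts_at M p" "e \<in> charts_at M p" for d e
    using manifold_transition(1)[OF M] that by (auto simp: charts_at_def)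
  have pE: "snd d p \<in> ?E" if "d \<in> charts_at M p" for d
    using op[OF that that] openin_imp_subset by blast
  have maps: "local_rep d e id ` (snd d ` (fst d \<inter> fst e)) \<subseteq> ?E"
    if de: "d \<in> charts_at M p" "e \<in> charts_at M p" for d e
  proof -
    have "local_rep d e id ` (snd d ` (fst d \<inter> fst e)) \<subseteq> snd e ` (fst e \<inter> fst d)"
      using inj de by (auto simp: local_rep_apply)
    then show ?thesis
      using openin_imp_subset[OF op(1)[OF de(2,1)]] by blast
  qed
  have range: "?D c d w \<in> ?E" if "d \<in> charts_at M p" for d
    using has_derivative_within_range[OF E E op[OF c that] maps[OF c that]
        transition_has_derivative[OF M r c that] w] .
  have chain: "?D d e (?D c d w) = ?D c e w" if d: "d \<in> charts_at M p" and e: "e \<in> charts_at M p" for d e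
  proof -
    have eq: "local_rep c d id (snd c p) = snd d p"
      using inj c by (simp add: local_rep_apply charts_at_def)
    have *: "((local_rep d e id \<circ> local_rep c d id) has_derivative (?D d e \<circ> ?D c d)) (at (snd c p) within ?E)"
      using transition_has_derivative[OF M r d e] eq
      by (intro has_derivative_within_chain[OF op[OF c d] maps[OF c d] transition_has_derivative[OF M r c d]]) simp
    \<comment> \<open>The image of the triple overlap, where both sides of the cocycle identity for
      transition maps are controlled.\<close>
    let ?S = "snd c ` (fst c \<inter> fst d) \<inter> snd c ` (fst c \<inter> fst e)"
    have "openin (top_of_set ?E) ?S"
      using op c d e by (intro openin_Int) auto
    moreover have "snd c p \<in> ?S"
      using op c d e by auto
    moreover have "(local_rep d e id \<circ> local_rep c d id) z = local_rep c e id z" if z: "z \<in> ?S" for z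
    proof -
      obtain q where "q \<in> fst c" "q \<in> fst d" "z = snd c q"
        using z by auto
      then show ?thesis
        using inj c d by (simp add: local_rep_apply)
    qed
    ultimately have "(local_rep c e id has_derivative (?D d e \<circ> ?D c d)) (at (snd c p) within ?E)"
      using * by (rule has_derivative_within_cong)
    then have "(?D d e \<circ> ?D c d) w = ?D c e w"
      using has_derivative_within_subspace_unique[OF E pE[OF c] w] transition_has_derivative[OF M r c e] by blast
    then show ?thesis by simp
  qed
  show "tvec_of M c p w \<in> tangent_space M p"
    by (rule tangent_spaceI) (simp_all add: tvec_of_def range chain)
  have "local_rep c c id z = z" if "z \<in> snd c ` (fst c \<inter> fst c)" for z
    using that inj c by (auto simp: local_rep_apply)
  then have "(local_rep c c id has_derivative (\<lambda>z. z)) (at (snd c p) within ?E)"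
    by (intro has_derivative_within_cong[OF op[OF c c] _ has_derivative_ident]) simp
  then have "?D c c w = w"
    using has_derivative_within_subspace_unique[OF E pE[OF c] w] transition_has_derivative[OF M r c c] by blast
  then show "tvec_of M c p w c = w"
    using c by (simp add: tvec_of_def)
qed

lemma chart_component_image:
  assumes "manifold r M" "1 \<le> r" "c \<in> charts_at M p"
  shows "(\<lambda>v. v c) ` tangent_space M p = model M"
proof
  show "(\<lambda>v. v c) ` tangent_space M p \<subseteq> model M"
    using assms(3) by (intro image_subsetI) (rule tangent_spaceD(1))
  show "model M \<subseteq> (\<lambda>v. v c) ` tangent_space M p"
    using tvec_of_in_tangent_space[OF assms] tvec_of_component[OF assms, symmetric]
    by (intro subsetI) (rule image_eqI)
qed

lemma linear_component: "linear (\<lambda>v :: 'i \<Rightarrow> 'v::real_vector. v c)"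
  by (rule linearI) auto

text \<open>Allows dimensions of subspaces of a tangent space to be computed in the Euclidean model
  space.\<close>

lemma dim_chart_component:
  assumes M: "manifold r M" "1 \<le> r" and c: "c \<in> charts_at M p"
    and V: "subspace V" "V \<subseteq> tangent_space M p"
  shows "dim ((\<lambda>v. v c) ` V) = dim V"
  using linear_component V(1) inj_on_subset[OF inj_on_chart_component[OF c] V(2)]
  by (rule dim_linear_image_inj_on)

lemma dim_tangent_space:
  assumes "manifold r M" "1 \<le> r" "p \<in> points M"
  shows "dim (tangent_space M p) = mdim M"
proof -
  obtain c where "c \<in> charts_at M p"
    using assms(3) by (auto simp: points_eq charts_at_def)
  then show ?thesis
    using dim_chart_component[OF assms(1,2) _ subspace_tangent_space[OF assms(1,2)] order_refl]
      chart_component_image[OF assms(1,2)] by (simp add: mdim_def)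
qed

lemma linear_tangent_map:
  assumes f: "smooth_map k M N f" and k: "1 \<le> k" and p: "p \<in> points M"
  shows "linear (tangent_map M N f p)"
proof -
  \<comment> \<open>The same choice as in \<open>tangent_map\<close>; \<open>p\<close> lies in some
    chart, so the chosen \<open>c\<close> really is a chart around \<open>p\<close>.\<close>
  define c where "c = (SOME c. c \<in> charts_at M p)"
  have "\<exists>c. c \<in> charts_at M p"
    using p by (auto simp: points_eq charts_at_def)
  then have c: "c \<in> charts_at M p"
    unfolding c_def by (rule someI_ex)
  have L: "linear (frechet_derivative (local_rep c d f) (at (snd c p) within model M))"
    if "d \<in> charts_at N (f p)" for d
  proof -
    have "smooth_on k (model M) (snd c ` {q\<in>fst c. f q \<in> fst d}) (local_rep c d f)"
      using f c that by (simp add: smooth_map_def charts_at_def)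
    then show ?thesis
      using k c that
      by (intro linear_frechet_derivative smooth_on_differentiable) (auto simp: charts_at_def)
  qed
  have eq: "tangent_map M N f p v = (\<lambda>d. if d \<in> charts_at N (f p)
      then frechet_derivative (local_rep c d f) (at (snd c p) within model M) (v c) else 0)" for v
    unfolding tangent_map_def Let_def c_def ..
  show ?thesis
    by (rule linearI; rule ext) (simp_all add: eq linear_add[OF L] linear_scale[OF L])
qed


section \<open>The kernel of a compatible pseudo-metric\<close>

text \<open>A trivialisation around the base point of \<open>a\<close> is a diffeomorphism from an
  open part of the total space onto a product with the fibre. Restricting to open parts keeps the
  model space, so the local dimension count is the global one.\<close>

lemma vector_bundle_mdim:
  fixes A :: "('a, 'e::euclidean_space, 'b, 'd::euclidean_space, 'f::euclidean_space) vbundle"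
  assumes A: "vector_bundle k A" and k: "1 \<le> k" and a: "a \<in> points (total_space A)"
  shows "mdim (total_space A) = mdim (base_space A) + dim (fibre A)"
proof -
  let ?M = "total_space A" and ?B = "base_space A" and ?F = "fibre A"
  have M: "continuous_atlas ?M" and B: "continuous_atlas ?B"
    using A manifold_continuous_atlas by (auto simp: vector_bundle_def)
  have F: "subspace ?F"
    using A by (simp add: vector_bundle_def)
  have "proj A a \<in> (\<Union>t\<in>trivs A. fst t)"
    using A a unfolding vector_bundle_def by blast
  then obtain t where t: "t \<in> trivs A" "proj A a \<in> fst t"
    by blast
  let ?W = "fst t"
  have W: "openin (mtop ?B) ?W"
    and df: "diffeo k (open_sub ?M (over A ?W)) (prod_mfd (open_sub ?B ?W) (vs_mfd ?F)) (triv_map A t)"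
    and pr: "continuous_map (mtop ?M) (mtop ?B) (proj A)"
    using A t(1) by (simp_all add: vector_bundle_def smooth_map_def)
  \<comment> \<open>Continuity of the projection makes the part over \<open>?W\<close> open, hence
    an open submanifold with a continuous atlas.\<close>
  have oW: "openin (mtop ?M) (over A ?W)"
    unfolding over_def topspace_mtop[symmetric] using pr W by (rule openin_continuous_map_preimage)
  have "a \<in> points (open_sub ?M (over A ?W))"
    using a t(2) by (auto simp: points_def open_sub_def over_def)
  then have "mdim (open_sub ?M (over A ?W)) = mdim (prod_mfd (open_sub ?B ?W) (vs_mfd ?F))"
    using k df M B F oW W
    by (intro diffeo_mdim_eq[where k = k]) (auto intro: continuous_atlas_open_sub continuous_atlas_prod continuous_atlas_vs_mfd)
  moreover have "subspace (model ?B)"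
    using B by (simp add: continuous_atlas_def)
  ultimately show ?thesis
    using F by (simp add: mdim_def open_sub_def prod_mfd_def vs_mfd_def dim_Times)
qed

lemma subspace_metric_kernel:
  assumes T: "subspace (tangent_space M p)" and h: "bilinear_form_on (tangent_space M p) (h p)"
  shows "subspace (metric_kernel M h p)"
proof -
  have "h p 0 w = 0" if "w \<in> tangent_space M p" for w
    using bilinear_form_onD(3)[OF h _ _ that, of 0 0 0] T subspace_0 by auto
  then show ?thesis
    using T unfolding subspace_def metric_kernel_def
    by (auto simp: bilinear_form_onD[OF h])
qed

theorem mainTheorem6:
  fixes k :: enat
    and A :: "('a, 'e::euclidean_space, 'b, 'd::euclidean_space, 'f::euclidean_space) vbundle"
    and g :: "('b, 'd) form_field"
    and \<gamma> \<theta> :: "('a, 'e, 'b, 'd) lift"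
    and \<gg> :: "('a, 'e) form_field"
  assumes "1 \<le> k"
    and "vector_bundle k A"
    and "riemannian_metric k (base_space A) g"
    and "connection k A \<gamma>"
    and "solder_form k A \<theta>"
    and "pseudo_metric k (total_space A) \<gg>"
    and "compatible A g \<gamma> \<theta> \<gg>"
  shows "(\<forall>a\<in>points (total_space A).
            horizontal A (\<gamma> - \<theta>) a \<subseteq> metric_kernel (total_space A) \<gg> a \<and>
            mdim (base_space A) \<le> dim (metric_kernel (total_space A) \<gg> a) \<and>
            dim (metric_kernel (total_space A) \<gg> a) \<le> dim (fibre A)) \<and>
         (mdim (base_space A) = dim (fibre A) \<longrightarrow>
            (\<forall>a\<in>points (total_space A). metric_kernel (total_space A) \<gg> a = horizontal A (\<gamma> - \<theta>) a))"
proof -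
  have "horizontal A (\<gamma> - \<theta>) a \<subseteq> metric_kernel (total_space A) \<gg> a \<and>
        mdim (base_space A) \<le> dim (metric_kernel (total_space A) \<gg> a) \<and>
        dim (metric_kernel (total_space A) \<gg> a) \<le> dim (fibre A) \<and>
        (mdim (base_space A) = dim (fibre A) \<longrightarrow>
          metric_kernel (total_space A) \<gg> a = horizontal A (\<gamma> - \<theta>) a)"
    if a: "a \<in> points (total_space A)" for a
  proof -
    let ?M = "total_space A" and ?B = "base_space A"
    let ?T = "total_tangent A a" and ?Tb = "base_tangent A a" and ?g = "g (proj A a)"
    let ?K = "metric_kernel ?M \<gg> a" and ?H = "horizontal A (\<gamma> - \<theta>) a"
    have k1: "1 \<le> k + 1"
      by simp
    have mfd: "manifold (k + 1) ?M" "manifold (k + 1) ?B"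
      and p: "proj A a \<in> points ?B" and sm: "smooth_map k ?M ?B (proj A)"
      using assms(2) a unfolding vector_bundle_def by blast+
    have T: "subspace ?T" and Tb: "subspace ?Tb"
      using mfd k1 by (blast intro: subspace_tangent_space)+
    have tp: "linear (tproj A a)"
      using sm assms(1) a by (rule linear_tangent_map)
    have \<gamma>: "linear_betw ?Tb ?T (\<gamma> a)" and \<gamma>sec: "\<And>u. u \<in> ?Tb \<Longrightarrow> tproj A a (\<gamma> a u) = u"
      using assms(4) a by (simp_all add: connection_def)
    have \<theta>: "linear_betw ?Tb (vertical A a) (\<theta> a)"
      using assms(5) a by (simp add: solder_form_def)
    have \<theta>v: "\<theta> a u \<in> ?T" "tproj A a (\<theta> a u) = 0" if "u \<in> ?Tb" for u
      using \<theta> that unfolding linear_betw_def vertical_def by auto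
    have \<gamma>T: "\<gamma> a u \<in> ?T" if "u \<in> ?Tb" for u
      using \<gamma> that unfolding linear_betw_def by blast
    have hb: "bilinear_form_on ?T (\<gg> a)"
      and hs: "\<And>u v. u \<in> ?T \<Longrightarrow> v \<in> ?T \<Longrightarrow> \<gg> a u v = \<gg> a v u"
      and hp: "\<And>u. u \<in> ?T \<Longrightarrow> 0 \<le> \<gg> a u u"
      using assms(6) a by (simp_all add: pseudo_metric_def smooth_form_field_def)
    have gb: "bilinear_form_on ?Tb ?g" and gp: "\<And>u. u \<in> ?Tb \<Longrightarrow> u \<noteq> 0 \<Longrightarrow> ?g u u > 0"
      using assms(3) p by (simp_all add: riemannian_metric_def pseudo_metric_def smooth_form_field_def)
    have comp: "\<gg> a (\<theta> a u + \<gamma> a w) (\<theta> a u' + \<gamma> a w') = ?g (u + w) (u' + w')"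
      if "u \<in> ?Tb" "w \<in> ?Tb" "u' \<in> ?Tb" "w' \<in> ?Tb" for u w u' w'
      using assms(7) a that unfolding compatible_def by blast
    have z: "0 \<in> ?Tb"
      using Tb by (rule subspace_0)

    \<comment> \<open>The difference map and its image in the kernel\<close>
    define \<eta> where "\<eta> = (\<gamma> - \<theta>) a"
    have \<eta>: "\<eta> u = \<gamma> a u - \<theta> a u" for u
      by (simp add: \<eta>_def fun_diff_def)
    have \<eta>T: "\<eta> u \<in> ?T" if "u \<in> ?Tb" for u
      unfolding \<eta> using T \<gamma>T \<theta>v that by (blast intro: subspace_diff)
    have \<eta>lin: "linear_betw ?Tb ?T \<eta>"
      unfolding linear_betw_def
    proof (intro conjI ballI allI)
      show "\<eta> ` ?Tb \<subseteq> ?T"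
        using \<eta>T by blast
      show "\<eta> (u + v) = \<eta> u + \<eta> v" if "u \<in> ?Tb" "v \<in> ?Tb" for u v
        using \<gamma> \<theta> that by (simp add: \<eta> linear_betw_def)
      show "\<eta> (r *\<^sub>R u) = r *\<^sub>R \<eta> u" if "u \<in> ?Tb" for r u
        using \<gamma> \<theta> that by (simp add: \<eta> linear_betw_def scaleR_right_diff_distrib)
    qed
    have "tproj A a (\<eta> u) = u" if "u \<in> ?Tb" for u
      using \<gamma>sec[OF that] \<theta>v(2)[OF that] by (simp add: \<eta> linear_diff[OF tp])
    then have \<eta>inj: "inj_on \<eta> ?Tb"
      by (metis inj_on_inverseI)
    have H: "?H = \<eta> ` ?Tb"
      by (simp add: horizontal_def \<eta>_def)

    have HK: "?H \<subseteq> ?K"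
    proof
      fix x assume "x \<in> ?H"
      then obtain u where u: "u \<in> ?Tb" "x = \<eta> u"
        unfolding H by blast
      have mu: "- u \<in> ?Tb"
        using Tb u(1) by (rule subspace_neg)
      \<comment> \<open>Moving the sign into the argument of \<open>\<theta>\<close> writes
        \<open>x\<close> as \<open>\<theta> a (- u) + \<gamma> a u\<close>, the shape to which
        \<open>comp\<close> applies; the two base vectors then add up to zero.\<close>
      have "\<theta> a ((-1) *\<^sub>R u) = (-1) *\<^sub>R \<theta> a u"
        using \<theta> u(1) unfolding linear_betw_def by blast
      then have "x = \<theta> a (- u) + \<gamma> a u"
        by (simp add: u(2) \<eta>)
      then have "\<gg> a x x = ?g 0 0"
        using comp[OF mu u(1) mu u(1)] by simp
      also have "\<dots> = 0"
        using bilinear_form_onD(3)[OF gb z z z, of 0] by simp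
      finally have "\<gg> a x x = 0" .
      moreover have xT: "x \<in> ?T"
        using u \<eta>T by simp
      ultimately have "\<gg> a x w = 0" if "w \<in> ?T" for w
        using semidefinite_null_vector[OF T hb hs hp] that by blast
      with xT show "x \<in> ?K"
        by (simp add: metric_kernel_def)
    qed

    \<comment> \<open>Dimension bounds and the case of equality\<close>
    have Ks: "subspace ?K" and KT: "?K \<subseteq> ?T"
      using subspace_metric_kernel[of ?M a \<gg>, OF T hb] unfolding metric_kernel_def by simp_all
    have Hs: "subspace ?H" and dimH: "dim ?H = mdim ?B"
      unfolding H using linear_betw_image[OF Tb \<eta>lin \<eta>inj] dim_tangent_space[OF mfd(2) k1 p] by simp_all
    have \<gamma>inj: "inj_on (\<gamma> a) ?Tb"
      using \<gamma>sec by (metis inj_on_inverseI)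
    let ?G = "\<gamma> a ` ?Tb"
    have Gs: "subspace ?G" and dimG: "dim ?G = mdim ?B" and GT: "?G \<subseteq> ?T"
      using linear_betw_image[OF Tb \<gamma> \<gamma>inj] dim_tangent_space[OF mfd(2) k1 p] \<gamma>T by auto
    have KG: "?K \<inter> ?G \<subseteq> {0}"
    proof
      fix x assume x: "x \<in> ?K \<inter> ?G"
      then obtain u where u: "u \<in> ?Tb" "x = \<gamma> a u"
        by blast
      \<comment> \<open>Since \<open>\<theta> a 0 = 0\<close>, the vector
        \<open>\<gamma> a u\<close> equals \<open>\<theta> a 0 + \<gamma> a u\<close>, so
        \<open>comp\<close> computes its square as that of \<open>u\<close> in the positive definite
        metric.\<close>
      have "\<theta> a (0 *\<^sub>R 0) = 0 *\<^sub>R \<theta> a 0" "\<gamma> a (0 *\<^sub>R 0) = 0 *\<^sub>R \<gamma> a 0"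
        using \<theta> \<gamma> z unfolding linear_betw_def by blast+
      then have zero: "\<theta> a 0 = 0" "\<gamma> a 0 = 0"
        by simp_all
      have "\<gg> a x x = 0"
        using x GT by (auto simp: metric_kernel_def)
      then have "?g u u = 0"
        using comp[OF z u(1) z u(1)] zero u(2) by simp
      then have "u = 0"
        using gp[OF u(1)] by force
      then show "x \<in> {0}"
        using u(2) zero by simp
    qed

    \<comment> \<open>\<open>?T\<close> sits in an infinite-dimensional type; a chart moves the dimension count to the model space.\<close>
    obtain c where c: "c \<in> charts_at ?M a"
      using a by (auto simp: points_eq charts_at_def)
    let ?e = "\<lambda>v :: ('a, 'e) tvec. v c"
    have einj: "inj_on ?e ?T"
      using c by (rule inj_on_chart_component)
    have dime: "dim (?e ` V) = dim V" if "subspace V" "V \<subseteq> ?T" for V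
      using dim_chart_component[OF mfd(1) k1 c that] .
    have sube: "subspace (?e ` V)" if "subspace V" for V
      using linear_subspace_image[OF linear_component that] .
    have "?e ` ?H \<subseteq> ?e ` ?K"
      using HK by (rule image_mono)
    then have le1: "dim ?H \<le> dim ?K"
      using dim_subset[of "?e ` ?H" "?e ` ?K"] dime[OF Hs] dime[OF Ks KT] HK KT by simp
    \<comment> \<open>Injectivity of \<open>?e\<close> on the tangent space makes images commute
      with intersections, so the trivial intersection persists in the model space.\<close>
    have "?e ` ?K \<inter> ?e ` ?G = ?e ` (?K \<inter> ?G)"
      using inj_on_image_Int[OF einj KT GT] by simp
    also have "\<dots> \<subseteq> {0}"
      using KG by auto
    finally have "dim (?e ` ?K \<inter> ?e ` ?G) = 0"
      by simp
    then have "dim {x + y | x y. x \<in> ?e ` ?K \<and> y \<in> ?e ` ?G} = dim ?K + dim ?G"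
      using dim_sums_Int[OF sube[OF Ks] sube[OF Gs]] dime[OF Ks KT] dime[OF Gs GT] by linarith
    moreover have "dim {x + y | x y. x \<in> ?e ` ?K \<and> y \<in> ?e ` ?G} \<le> dim (model ?M)"
    proof -
      have "?e ` ?T = model ?M"
        using mfd(1) k1 c by (rule chart_component_image)
      then have "?e ` ?K \<subseteq> model ?M" "?e ` ?G \<subseteq> model ?M"
        using image_mono[OF KT, of ?e] image_mono[OF GT, of ?e] by simp_all
      moreover have "subspace (model ?M)"
        using mfd(1) by (simp add: manifold_def)
      ultimately show ?thesis
        by (intro dim_subset) (blast intro: subspace_add)
    qed
    ultimately have "dim ?K + dim ?G \<le> mdim ?M"
      by (simp add: mdim_def)
    \<comment> \<open>The image of \<open>\<gamma>\<close> accounts for the dimension of the base;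
      cancelling it in the dimension of the total space leaves the fibre.\<close>
    then have le2: "dim ?K \<le> dim (fibre A)"
      using vector_bundle_mdim[OF assms(2,1) a] dimG by simp
    have "?K = ?H" if eq: "mdim ?B = dim (fibre A)"
    proof -
      \<comment> \<open>The lower and upper bounds now coincide. Nested subspaces of the model space
        with equal dimension are equal, and injectivity of \<open>?e\<close> carries this back to
        the tangent space.\<close>
      have "dim (?e ` ?K) \<le> dim (?e ` ?H)"
        using dime[OF Hs] dime[OF Ks KT] HK KT le2 dimH eq by simp
      then have "?e ` ?H = ?e ` ?K"
        using subspace_dim_equal[OF sube[OF Hs] sube[OF Ks] image_mono[OF HK]] by blast
      then show ?thesis
        using inj_on_image_eq_iff[OF einj order_trans[OF HK KT] KT] by blast
    qed
    with HK le1 le2 dimH show ?thesis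
      by simp
  qed
  then show ?thesis
    by blast
qed

end
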